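(* Let $K\subset\mathbb{R}^d$ be compact and convex, let $f$ be an $\mathbb{R}^d$-valued function that is Lipschitz continuous on $K$, let $g$ be an $\mathbb{R}^d$-valued function of two variables that is Lipschitz continuous in both arguments, and let $\eta$ be a continuously differentiable $\mathbb{R}^d$-valued function of two variables. Let $\phi_1,\dots,\phi_M\in\mathbf{C}^1(K)$ and $\psi_1,\dots,\psi_{M_L}\in\mathbf{C}(K)$ be kernel functions. Let $y_1,\dots,y_{N_L}$ be leader trajectories with $y_j(t)\in K$, and let $x_1,\dots,x_N$ be agents with $$\dot x_i(t)=f(x_i)+\frac1N\sum_{j=1}^N g(x_i,x_j)+\sum_{j=1}^{N_L}\eta(x_i,y_j),\qquad i=1,\dots,N,$$ such that $x_i(t)\in K$ for all $i$ and all $t\in[0,T]$. Let $m(t)=(m_1(t),\dots,m_M(t))$ be the true moments, $m_k(t)=\frac1N\sum_{i=1}^N\phi_k(x_i(t))$. Given real matrices $A=[a^k_\ell]_{k,\ell=1}^M$, $B_k=[b^k_{\ell,j}]_{\ell,j=1}^M$ ($k=1,\dots,M$) and $\Gamma_r=[\gamma^k_{\ell,r}]_{k,\ell=1}^M$ ($r=1,\dots,M_L$), let $\overline m(t)\in\mathbb{R}^M$ be the solution of $$\dot{\overline m}(t)=A\overline m(t)+\mathbb{B}(\overline m(t))+\sum_{j=1}^{N_L}\sum_{r=1}^{M_L}\psi_r(y_j(t))\,\Gamma_r\,\overline m(t),\qquad \mathbb{B}(m)=(m^TB_1^Tm,\dots,m^TB_M^Tm).$$ Let $D\subset\mathbb{R}^M$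 be a compact and convex set, and assume that $\overline m(t)\in D$ for $t\in[0,\overline T]$. For $x,y\in K$ and $Y=(y_1,\dots,y_{N_L})\in K^{N_L}$ let $$\varepsilon_k(x,y,Y)=\varepsilon^f_k(x)+\varepsilon^g_k(x,y)+\sum_{j=1}^{N_L}\varepsilon^\eta_k(x,y_j),$$ where $$\varepsilon^f_k(x)=\tfrac{\partial\phi_k(x)}{\partial x}f(x)-\sum_{\ell=1}^M a^k_\ell\phi_\ell(x),\qquad \varepsilon^g_k(x,y)=\tfrac{\partial\phi_k(x)}{\partial x}g(x,y)-\sum_{\ell,j=1}^M b^k_{\ell,j}\phi_\ell(x)\phi_j(y),$$ $$\varepsilon^\eta_k(x,y)=\tfrac{\partial\phi_k(x)}{\partial x}\eta(x,y)-\sum_{\ell=1}^M\sum_{r=1}^{M_L}\gamma^k_{\ell,r}\psi_r(y)\phi_\ell(x).$$ Let $\zeta=\nu[A]+\beta+\tau$, where $$\beta=\max_{m\in D}\sum_{\ell=1}^M\nu[m_\ell\widetilde B_\ell],\quad \widetilde B_\ell=[b^i_{\ell,j}+b^i_{j,\ell}]_{i,j=1}^M,\qquad \tau=\max_{Y\in K^{N_L}}\nu\Big[\sum_{j=1}^{N_L}\sum_{r=1}^{M_L}\psi_r(y_j)\Gamma_r\Big].$$ If $\zeta\ne0$, then for $t\in[0,\min(T,\overline T)]$ the norm of the error trajectory $\Delta m(t)=m(t)-\overline m(t)$ is bounded by $$\|\Delta m(t)\|\le\|\Delta m(0)\|e^{\zeta t}+\frac{e^{\zeta t}-1}{\zeta}\sqrt{\sum_{k=1}^M\max_{x,y\in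 K,\;Y\in K^{N_L}}\varepsilon_k(x,y,Y)^2}.$$
   Context: $\|\cdot\|$ denotes the Euclidean vector norm and the induced matrix norm. $\mathbf{C}(K)$ and $\mathbf{C}^1(K)$ are the sets of continuous and continuously differentiable real-valued functions on $K$; $\partial\phi_k/\partial x$ is the gradient as a row vector. The logarithmic $2$-norm of a square real matrix $A$ is $\nu[A]=\lim_{h\to0^+}\frac{\|I+hA\|-1}{h}$, which equals $\lambda_{\max}(A+A^* )/2$, where $\lambda_{\max}$ is the maximal eigenvalue. In $A$ and $\Gamma_r$, $k$ is the row index and $\ell$ the column index; in $\widetilde B_\ell$, $i$ is the row index and $j$ the column index. The leaders are governed by controlled ordinary differential equations $\dot y_j=f_L(y_j,u_j)$ with control signals $u_j$. A natural choice of $D$ is the set of all vectors $\left(\int_K\phi_k\,d\mu\right)_{k=1}^M$ with $\mu$ a nonnegative measure on $K$ of total mass $1$.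
   Formalization: The formal theorem additionally assumes that the true moments m(t) lie in D for t in [0, min(T, T̄)]; without this the claim fails (e.g. D={0}, m̄=0, x'=-x+x²), and it holds whenever D contains the natural choice of moment vectors. *)

theory Defs
  imports "HOL-Analysis.Analysis"
begin

text \<open>The norm on \<open>real ^ 'm ^ 'm\<close> is the Frobenius norm, so the induced matrix norm
  has to be written as the operator norm of the associated linear map.\<close>

definition log_norm :: "real ^ 'm ^ 'm \<Rightarrow> real" where
  "log_norm A = Lim (at_right 0) (\<lambda>h. (onorm ((*v) (mat 1 + h *\<^sub>R A)) - 1) / h)"

text \<open>Continuous differentiability on a set that need not be open. Derivatives are taken
  within the set; if the set is convex with empty interior, they need not be unique.\<close>

definition C1_on :: "'a::real_normed_vector set \<Rightarrow> ('a \<Rightarrow> 'b::real_normed_vector) \<Rightarrow> bool" where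
  "C1_on S h \<longleftrightarrow> (\<exists>h' :: 'a \<Rightarrow> 'a \<Rightarrow>\<^sub>L 'b. continuous_on S h' \<and>
     (\<forall>x\<in>S. (h has_derivative blinfun_apply (h' x)) (at x within S)))"

text \<open>For scalar functions the gradient is kept as explicit data, so that statements about it
  cover every admissible choice when the set has empty interior.\<close>

definition has_C1_gradient_on ::
    "(real ^ 'd \<Rightarrow> real) \<Rightarrow> (real ^ 'd \<Rightarrow> real ^ 'd) \<Rightarrow> (real ^ 'd) set \<Rightarrow> bool" where
  "has_C1_gradient_on h grad S \<longleftrightarrow> continuous_on S grad \<and>
     (\<forall>x\<in>S. (h has_derivative (\<lambda>v. grad x \<bullet> v)) (at x within S))"

definition moments ::
    "('m \<Rightarrow> real ^ 'd \<Rightarrow> real) \<Rightarrow> ('n::finite \<Rightarrow> real \<Rightarrow> real ^ 'd) \<Rightarrow> real \<Rightarrow> real ^ 'm" where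
  "moments \<phi> x t = (\<chi> k. 1 / real CARD('n) * (\<Sum>i\<in>UNIV. \<phi> k (x i t)))"

text \<open>Entries: \<open>B k $ l $ j\<close> is $b^k_{l,j}$, and \<open>\<Gamma> r $ k $ l\<close> is $\gamma^k_{l,r}$.\<close>

definition quad_map :: "('m \<Rightarrow> real ^ 'm ^ 'm) \<Rightarrow> real ^ 'm \<Rightarrow> real ^ 'm" where
  "quad_map B m = (\<chi> k. m \<bullet> (transpose (B k) *v m))"

definition B_tilde :: "('m \<Rightarrow> real ^ 'm ^ 'm) \<Rightarrow> 'm \<Rightarrow> real ^ 'm ^ 'm" where
  "B_tilde B l = (\<chi> i j. B i $ l $ j + B i $ j $ l)"

definition leader_matrix ::
    "('r::finite \<Rightarrow> real ^ 'd \<Rightarrow> real) \<Rightarrow> ('r \<Rightarrow> real ^ 'm ^ 'm)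
      \<Rightarrow> ('l::finite \<Rightarrow> real ^ 'd) \<Rightarrow> real ^ 'm ^ 'm" where
  "leader_matrix \<psi> \<Gamma> Y = (\<Sum>j\<in>UNIV. \<Sum>r\<in>UNIV. \<psi> r (Y j) *\<^sub>R \<Gamma> r)"

definition eps_f ::
    "('m \<Rightarrow> real ^ 'd \<Rightarrow> real) \<Rightarrow> ('m \<Rightarrow> real ^ 'd \<Rightarrow> real ^ 'd) \<Rightarrow> (real ^ 'd \<Rightarrow> real ^ 'd)
      \<Rightarrow> real ^ 'm ^ 'm \<Rightarrow> 'm \<Rightarrow> real ^ 'd \<Rightarrow> real" where
  "eps_f \<phi> grad\<phi> f A k x = grad\<phi> k x \<bullet> f x - (\<Sum>l\<in>UNIV. A $ k $ l * \<phi> l x)"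

definition eps_g ::
    "('m \<Rightarrow> real ^ 'd \<Rightarrow> real) \<Rightarrow> ('m \<Rightarrow> real ^ 'd \<Rightarrow> real ^ 'd)
      \<Rightarrow> (real ^ 'd \<Rightarrow> real ^ 'd \<Rightarrow> real ^ 'd) \<Rightarrow> ('m \<Rightarrow> real ^ 'm ^ 'm)
      \<Rightarrow> 'm \<Rightarrow> real ^ 'd \<Rightarrow> real ^ 'd \<Rightarrow> real" where
  "eps_g \<phi> grad\<phi> g B k x y =
     grad\<phi> k x \<bullet> g x y - (\<Sum>l\<in>UNIV. \<Sum>j\<in>UNIV. B k $ l $ j * \<phi> l x * \<phi> j y)"

definition eps_eta ::
    "('m \<Rightarrow> real ^ 'd \<Rightarrow> real) \<Rightarrow> ('m \<Rightarrow> real ^ 'd \<Rightarrow> real ^ 'd)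
      \<Rightarrow> ('r::finite \<Rightarrow> real ^ 'd \<Rightarrow> real) \<Rightarrow> (real ^ 'd \<Rightarrow> real ^ 'd \<Rightarrow> real ^ 'd)
      \<Rightarrow> ('r \<Rightarrow> real ^ 'm ^ 'm) \<Rightarrow> 'm \<Rightarrow> real ^ 'd \<Rightarrow> real ^ 'd \<Rightarrow> real" where
  "eps_eta \<phi> grad\<phi> \<psi> \<eta> \<Gamma> k x y =
     grad\<phi> k x \<bullet> \<eta> x y - (\<Sum>l\<in>UNIV. \<Sum>r\<in>UNIV. \<Gamma> r $ k $ l * \<psi> r y * \<phi> l x)"

definition eps ::
    "('m \<Rightarrow> real ^ 'd \<Rightarrow> real) \<Rightarrow> ('m \<Rightarrow> real ^ 'd \<Rightarrow> real ^ 'd)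
      \<Rightarrow> ('r::finite \<Rightarrow> real ^ 'd \<Rightarrow> real)
      \<Rightarrow> (real ^ 'd \<Rightarrow> real ^ 'd) \<Rightarrow> (real ^ 'd \<Rightarrow> real ^ 'd \<Rightarrow> real ^ 'd)
      \<Rightarrow> (real ^ 'd \<Rightarrow> real ^ 'd \<Rightarrow> real ^ 'd)
      \<Rightarrow> real ^ 'm ^ 'm \<Rightarrow> ('m \<Rightarrow> real ^ 'm ^ 'm) \<Rightarrow> ('r \<Rightarrow> real ^ 'm ^ 'm)
      \<Rightarrow> 'm \<Rightarrow> real ^ 'd \<Rightarrow> real ^ 'd \<Rightarrow> ('l::finite \<Rightarrow> real ^ 'd) \<Rightarrow> real" where
  "eps \<phi> grad\<phi> \<psi> f g \<eta> A B \<Gamma> k x y Y =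
     eps_f \<phi> grad\<phi> f A k x + eps_g \<phi> grad\<phi> g B k x y
       + (\<Sum>j\<in>UNIV. eps_eta \<phi> grad\<phi> \<psi> \<eta> \<Gamma> k x (Y j))"

text \<open>The maxima below are over compact sets of continuous functions, hence equal to the
  suprema. The type argument fixes the number of leaders in \<open>K\<^sup>N\<close>.\<close>

definition beta :: "(real ^ 'm) set \<Rightarrow> ('m \<Rightarrow> real ^ 'm ^ 'm) \<Rightarrow> real" where
  "beta D B = (SUP m\<in>D. \<Sum>l\<in>UNIV. log_norm (m $ l *\<^sub>R B_tilde B l))"

definition tau ::
    "'l::finite itself \<Rightarrow> (real ^ 'd) set \<Rightarrow> ('r::finite \<Rightarrow> real ^ 'd \<Rightarrow> real)
      \<Rightarrow> ('r \<Rightarrow> real ^ 'm ^ 'm) \<Rightarrow> real" where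
  "tau _ K \<psi> \<Gamma> =
     (SUP Y\<in>{Y :: 'l \<Rightarrow> real ^ 'd. \<forall>j. Y j \<in> K}. log_norm (leader_matrix \<psi> \<Gamma> Y))"

end

theory Submission 
  imports Defs
begin

text \<open>Since \<open>\<nu>[A]\<close> bounds the quadratic form \<open>x \<bullet> A x\<close> by \<open>\<nu>[A] \<parallel>x\<parallel>\<^sup>2\<close>, it controls the
  growth of \<open>\<parallel>\<Delta>m\<parallel>\<close>. The difference of the quadratic terms is exactly linear in \<open>\<Delta>m\<close>:
  \<open>quad_map B m - quad_map B n = (\<Sum>l. p\<^sub>l B_tilde B l) (m - n)\<close> with \<open>p = (m + n) / 2\<close>, which
  lies in \<open>D\<close> by convexity. Hence \<open>\<Delta>m \<bullet> \<Delta>m' \<le> \<zeta> \<parallel>\<Delta>m\<parallel>\<^sup>2 + c \<parallel>\<Delta>m\<parallel>\<close>, where \<open>c\<close> bounds the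
  defect of the true moments in the moment equation, and a Gronwall argument concludes.\<close>

section \<open>The logarithmic norm as an infimum, and its bound on the quadratic form\<close>

lemma scaled_identity_apply: "(mat 1 + h *\<^sub>R A) *v x = x + h *\<^sub>R (A *v x)" for A :: "real ^ 'm ^ 'm"
  by (simp add: matrix_vector_mult_add_rdistrib scaleR_matrix_vector_assoc)

text \<open>Cauchy-Schwarz for \<open>x\<close> and \<open>(mat 1 + h *\<^sub>R A) *v x\<close>: the
  left side is \<open>(norm x)\<^sup>2 + h * (x \<bullet> (A *v x))\<close>, so subtracting the
  identity part and dividing by \<open>h\<close> leaves the quotient from \<open>log_norm\<close>.
  The bound holds for every \<open>h > 0\<close>, not just in the limit.\<close>

lemma inner_le_log_norm_quotient:
  fixes A :: "real ^ 'm ^ 'm"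
  assumes "h > 0"
  shows "x \<bullet> (A *v x) \<le> (onorm ((*v) (mat 1 + h *\<^sub>R A)) - 1) / h * (norm x)\<^sup>2"
proof -
  have "(norm x)\<^sup>2 + h * (x \<bullet> (A *v x)) = x \<bullet> ((mat 1 + h *\<^sub>R A) *v x)"
    by (simp add: scaled_identity_apply inner_add_right power2_norm_eq_inner)
  also have "\<dots> \<le> norm x * norm ((mat 1 + h *\<^sub>R A) *v x)"
    by (rule norm_cauchy_schwarz)
  also have "\<dots> \<le> norm x * (onorm ((*v) (mat 1 + h *\<^sub>R A)) * norm x)"
    by (intro mult_left_mono onorm) auto
  finally have "h * (x \<bullet> (A *v x)) \<le> (onorm ((*v) (mat 1 + h *\<^sub>R A)) - 1) * (norm x)\<^sup>2"
    by (simp add: algebra_simps power2_eq_square)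
  then show ?thesis
    using assms by (simp add: field_simps)
qed

text \<open>Testing the previous inequality on one unit vector gives a lower bound that does not
  depend on \<open>h\<close>.\<close>

lemma bdd_below_log_norm_quotient:
  fixes A :: "real ^ 'm ^ 'm"
  shows "bdd_below ((\<lambda>h. (onorm ((*v) (mat 1 + h *\<^sub>R A)) - 1) / h) ` {0<..})"
proof -
  obtain e :: "real ^ 'm" where "norm e = 1"
    using vector_choose_size[of 1] by auto
  then show ?thesis
    using inner_le_log_norm_quotient[of _ e A]
    by (intro bdd_belowI2[where m = "e \<bullet> (A *v e)"]) simp
qed

text \<open>These are slopes of a convex function from 0: \<open>mat 1 + h *\<^sub>R A\<close> is
  the convex combination of the identity and \<open>mat 1 + k *\<^sub>R A\<close> with weights
  \<open>1 - h / k\<close> and \<open>h / k\<close>, and the identity has operator norm at most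
  1.\<close>

lemma log_norm_quotient_mono:
  fixes A :: "real ^ 'm ^ 'm"
  assumes "0 < h" "h \<le> k"
  shows "(onorm ((*v) (mat 1 + h *\<^sub>R A)) - 1) / h \<le> (onorm ((*v) (mat 1 + k *\<^sub>R A)) - 1) / k"
proof -
  let ?N = "\<lambda>h. onorm ((*v) (mat 1 + h *\<^sub>R A))"
  have bl: "bounded_linear (\<lambda>x. (h / k) *\<^sub>R ((mat 1 + k *\<^sub>R A) *v x))"
    by (intro bounded_linear_const_scaleR) auto
  have bl1: "bounded_linear (\<lambda>x::real ^ 'm. (1 - h / k) *\<^sub>R x)"
    by (intro bounded_linear_const_scaleR bounded_linear_ident)
  have "(*v) (mat 1 + h *\<^sub>R A)
      = (\<lambda>x. (1 - h / k) *\<^sub>R x + (h / k) *\<^sub>R ((mat 1 + k *\<^sub>R A) *v x))"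
    using assms by (auto simp: fun_eq_iff scaled_identity_apply scaleR_right_distrib scaleR_left_diff_distrib)
  then have "?N h \<le> onorm (\<lambda>x::real ^ 'm. (1 - h / k) *\<^sub>R x) + onorm (\<lambda>x. (h / k) *\<^sub>R ((mat 1 + k *\<^sub>R A) *v x))"
    using onorm_triangle[OF bl1 bl] by simp
  also have "\<dots> = (1 - h / k) * onorm (\<lambda>x::real ^ 'm. x) + h / k * ?N k"
    using assms by (simp add: onorm_scaleR bounded_linear_ident)
  also have "\<dots> \<le> (1 - h / k) * 1 + h / k * ?N k"
    using assms by (intro add_right_mono mult_left_mono onorm_id_le) auto
  finally have "?N h - 1 \<le> (?N k - 1) / k * h"
    by (simp add: algebra_simps diff_divide_distrib)
  then show ?thesis
    using assms by (subst pos_divide_le_eq)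
qed

text \<open>The limit exists because the difference quotient is monotone and bounded below.\<close>

lemma log_norm_eq_INF:
  fixes A :: "real ^ 'm ^ 'm"
  shows "log_norm A = (INF h\<in>{0<..}. (onorm ((*v) (mat 1 + h *\<^sub>R A)) - 1) / h)"
  unfolding log_norm_def
proof (rule tendsto_Lim, simp, rule decreasing_tendsto)
  let ?q = "\<lambda>h. (onorm ((*v) (mat 1 + h *\<^sub>R A)) - 1) / h"
  show "\<forall>\<^sub>F h in at_right 0. (INF h\<in>{0<..}. ?q h) \<le> ?q h"
    using eventually_at_right_less[of 0]
    by eventually_elim (auto intro: cINF_lower bdd_below_log_norm_quotient)
  \<comment> \<open>Some \<open>k\<close> already brings the quotient below \<open>z\<close>;
    monotonicity passes this on to every smaller positive \<open>h\<close>.\<close>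
  fix z assume "(INF h\<in>{0<..}. ?q h) < z"
  then obtain k where k: "0 < k" "?q k < z"
    using cInf_lessD[of "?q ` {0<..}" z] by auto
  show "\<forall>\<^sub>F h in at_right 0. ?q h < z"
    using eventually_at_right_real[OF k(1)]
  proof eventually_elim
    case (elim h)
    then show ?case
      using log_norm_quotient_mono[of h k A] k(2) by simp
  qed
qed

text \<open>After division by \<open>(norm x)\<^sup>2\<close> the left side is a lower bound for all
  quotients, hence for their infimum.\<close>

lemma inner_matrix_vector_le_log_norm:
  fixes A :: "real ^ 'm ^ 'm"
  shows "x \<bullet> (A *v x) \<le> log_norm A * (norm x)\<^sup>2"
proof (cases "x = 0")
  case False
  have "x \<bullet> (A *v x) / (norm x)\<^sup>2 \<le> log_norm A"
    unfolding log_norm_eq_INF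
  proof (rule cINF_greatest)
    fix h :: real assume "h \<in> {0<..}"
    then show "x \<bullet> (A *v x) / (norm x)\<^sup>2 \<le> (onorm ((*v) (mat 1 + h *\<^sub>R A)) - 1) / h"
      using inner_le_log_norm_quotient[of h x A] False by (subst pos_divide_le_eq) auto
  qed simp
  then show ?thesis
    using False by (subst (asm) pos_divide_le_eq) auto
qed simp

text \<open>Take the quotient at \<open>h = 1\<close> and apply the triangle inequality. This crude
  bound serves to show that the suprema in \<open>beta\<close> and \<open>tau\<close> are
  finite.\<close>

lemma log_norm_le_onorm:
  fixes A :: "real ^ 'm ^ 'm"
  shows "log_norm A \<le> onorm ((*v) A)"
proof -
  have "log_norm A \<le> (onorm ((*v) (mat 1 + 1 *\<^sub>R A)) - 1) / 1"
    unfolding log_norm_eq_INF by (rule cINF_lower[OF bdd_below_log_norm_quotient]) simp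
  also have "(*v) (mat 1 + 1 *\<^sub>R A) = (\<lambda>x. x + A *v x)"
    using scaled_identity_apply[of 1 A] by auto
  also have "(onorm \<dots> - 1) / 1 \<le> onorm ((*v) A)"
    using onorm_triangle[OF bounded_linear_ident, of "(*v) A"] onorm_id_le[where 'a = "real ^ 'm"]
    by simp
  finally show ?thesis .
qed

lemma onorm_scaleR_matrix:
  fixes A :: "real ^ 'n ^ 'm"
  shows "onorm ((*v) (c *\<^sub>R A)) = \<bar>c\<bar> * onorm ((*v) A)"
proof -
  have "(*v) (c *\<^sub>R A) = (\<lambda>v. c *\<^sub>R (A *v v))"
    by (simp add: fun_eq_iff scaleR_matrix_vector_assoc)
  then show ?thesis
    by (simp add: onorm_scaleR)
qed

section \<open>Increments of the quadratic moment map\<close>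

lemma quad_map_nth:
  fixes B :: "'m::finite \<Rightarrow> real ^ 'm ^ 'm"
  shows "quad_map B m $ k = (\<Sum>l\<in>UNIV. \<Sum>j\<in>UNIV. B k $ l $ j * m $ l * m $ j)"
  unfolding quad_map_def inner_vec_def matrix_vector_mult_def transpose_def
  by (subst sum.swap) (simp add: sum_distrib_left mult_ac)

text \<open>The increment of a quadratic map is its Jacobian at the midpoint applied to the
  difference of the arguments; the matrix \<open>\<Sum>l. p $ l *\<^sub>R B_tilde B l\<close> is the
  Jacobian of \<open>quad_map B\<close> at \<open>p\<close>.\<close>

lemma quad_map_diff:
  fixes B :: "'m::finite \<Rightarrow> real ^ 'm ^ 'm"
  shows "quad_map B m - quad_map B n
    = (\<Sum>l\<in>UNIV. ((1/2) *\<^sub>R (m + n)) $ l *\<^sub>R B_tilde B l) *v (m - n)"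
proof -
  have "quad_map B m $ i - quad_map B n $ i
    = ((\<Sum>l\<in>UNIV. ((1/2) *\<^sub>R (m + n)) $ l *\<^sub>R B_tilde B l) *v (m - n)) $ i" for i
  proof -
    let ?b = "\<lambda>l j. B i $ l $ j"
    have "((\<Sum>l\<in>UNIV. ((1/2) *\<^sub>R (m + n)) $ l *\<^sub>R B_tilde B l) *v (m - n)) $ i
      = (\<Sum>l\<in>UNIV. \<Sum>j\<in>UNIV. 1/2 * (m $ l + n $ l) * (?b l j + ?b j l) * (m $ j - n $ j))"
      unfolding matrix_vector_mult_def B_tilde_def
      by (subst sum.swap) (simp add: sum_distrib_right)
    also have "\<dots> = (\<Sum>l\<in>UNIV. \<Sum>j\<in>UNIV. 1/2 * (m $ l + n $ l) * ?b l j * (m $ j - n $ j))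
      + (\<Sum>l\<in>UNIV. \<Sum>j\<in>UNIV. 1/2 * (m $ l + n $ l) * ?b j l * (m $ j - n $ j))"
      by (simp add: sum.distrib[symmetric] algebra_simps)
    \<comment> \<open>Renaming indices in the transposed half gives both sums the same coefficient
      \<open>?b l j\<close>. The factors then add up to
      \<open>m $ l * m $ j - n $ l * n $ j\<close>, as the mixed terms cancel.\<close>
    also have "(\<Sum>l\<in>UNIV. \<Sum>j\<in>UNIV. 1/2 * (m $ l + n $ l) * ?b j l * (m $ j - n $ j))
      = (\<Sum>l\<in>UNIV. \<Sum>j\<in>UNIV. 1/2 * (m $ j + n $ j) * ?b l j * (m $ l - n $ l))"
      by (rule sum.swap)
    finally show ?thesis
      unfolding quad_map_nth by (simp only: sum.distrib[symmetric] sum_subtractf[symmetric])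
        (auto intro!: sum.cong simp: field_simps)
  qed
  then show ?thesis
    by (simp add: vec_eq_iff)
qed

section \<open>A Gronwall estimate for the norm\<close>

text \<open>The regularisation \<open>sqrt (\<parallel>v\<parallel>\<^sup>2 + \<delta>\<^sup>2)\<close> avoids the zeros of \<open>v\<close>, where the
  norm is not differentiable.\<close>

lemma norm_gronwall_regularized:
  fixes v :: "real \<Rightarrow> 'a::real_inner"
  assumes deriv: "\<And>s. s \<in> {0..t} \<Longrightarrow> (v has_vector_derivative v' s) (at s within {0..t})"
    and ineq: "\<And>s. s \<in> {0..t} \<Longrightarrow> v s \<bullet> v' s \<le> \<zeta> * (norm (v s))\<^sup>2 + c * norm (v s)"
    and "\<zeta> \<noteq> 0" "0 \<le> t" "0 \<le> c" "0 < \<delta>"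
  shows "norm (v t) \<le> sqrt ((norm (v 0))\<^sup>2 + \<delta>\<^sup>2) * exp (\<zeta> * t)
    + (exp (\<zeta> * t) - 1) / \<zeta> * (c + \<bar>\<zeta>\<bar> * \<delta>)"
proof -
  let ?r = "\<lambda>s. sqrt (v s \<bullet> v s + \<delta>\<^sup>2)"
  \<comment> \<open>The extra \<open>\<bar>\<zeta>\<bar> * \<delta>\<close> absorbs the term
    \<open>- \<zeta> * \<delta>\<^sup>2\<close> that arises when \<open>(norm (v s))\<^sup>2\<close>
    is written as \<open>(?r s)\<^sup>2 - \<delta>\<^sup>2\<close>, whatever the sign of
    \<open>\<zeta>\<close>.\<close>
  let ?c = "c + \<bar>\<zeta>\<bar> * \<delta>"
  \<comment> \<open>Integrating factor: \<open>?r' \<le> \<zeta> * ?r + ?c\<close> says exactly that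
    \<open>?w\<close> has nonpositive derivative.\<close>
  let ?w = "\<lambda>s. exp (- \<zeta> * s) * (?r s + ?c / \<zeta>)"
  have pos: "v s \<bullet> v s + \<delta>\<^sup>2 > 0" for s
    using \<open>0 < \<delta>\<close> by (intro add_nonneg_pos) auto
  have cont: "continuous_on {0..t} v"
    using deriv by (intro continuous_on_vector_derivative)
  have "?w t \<le> ?w 0"
  \<comment> \<open>At interior points the derivative within \<open>{0..t}\<close> is two-sided; the
    endpoints are covered by continuity.\<close>
  proof (rule DERIV_nonpos_imp_decreasing_open[OF \<open>0 \<le> t\<close>])
    show "continuous_on {0..t} ?w"
      by (intro continuous_intros cont)
    fix s assume s: "0 < s" "s < t"
    have "(v has_vector_derivative v' s) (at s)"
      using deriv[of s] s at_within_Icc_at[of 0 s t] by simp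
    then have dv: "(v has_derivative (\<lambda>h. h *\<^sub>R v' s)) (at s)"
      by (simp add: has_vector_derivative_def)
    have "((\<lambda>s. v s \<bullet> v s + \<delta>\<^sup>2) has_derivative (\<lambda>h. v s \<bullet> (h *\<^sub>R v' s) + (h *\<^sub>R v' s) \<bullet> v s)) (at s)"
      by (auto intro!: derivative_eq_intros dv)
    then have "((\<lambda>s. v s \<bullet> v s + \<delta>\<^sup>2) has_field_derivative 2 * (v s \<bullet> v' s)) (at s)"
      by (rule has_derivative_imp_has_field_derivative) (simp add: inner_commute)
    from DERIV_chain2[where f = sqrt and g = "\<lambda>s. v s \<bullet> v s + \<delta>\<^sup>2", OF DERIV_real_sqrt[OF pos] this]
    have "(?r has_field_derivative (v s \<bullet> v' s) / ?r s) (at s)"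
      by (rule DERIV_cong) (simp add: field_simps)
    moreover have "((\<lambda>s. exp (- \<zeta> * s)) has_field_derivative - \<zeta> * exp (- \<zeta> * s)) (at s)"
      by (auto intro!: derivative_eq_intros)
    ultimately have dw: "(?w has_field_derivative
        exp (- \<zeta> * s) * ((v s \<bullet> v' s) / ?r s - \<zeta> * ?r s - ?c)) (at s)"
      using \<open>\<zeta> \<noteq> 0\<close>
      by (intro DERIV_cong[OF DERIV_mult[OF _ DERIV_add[OF _ DERIV_const]]])
        (auto simp: field_simps)
    have r: "norm (v s) \<le> ?r s" "\<delta> \<le> ?r s" "?r s > 0" "(?r s)\<^sup>2 = (norm (v s))\<^sup>2 + \<delta>\<^sup>2"
      using pos[of s] \<open>0 < \<delta>\<close> by (auto intro!: real_le_rsqrt simp: power2_norm_eq_inner)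
    have "v s \<bullet> v' s \<le> \<zeta> * ((?r s)\<^sup>2 - \<delta>\<^sup>2) + c * norm (v s)"
      using ineq[of s] s r(4) by simp
    also have "\<dots> \<le> \<zeta> * (?r s)\<^sup>2 + \<bar>\<zeta>\<bar> * (\<delta> * ?r s) + c * ?r s"
    proof -
      have "- \<zeta> * (\<delta> * \<delta>) \<le> \<bar>\<zeta>\<bar> * (\<delta> * ?r s)"
        using r(2) \<open>0 < \<delta>\<close> by (intro mult_mono) auto
      moreover have "c * norm (v s) \<le> c * ?r s"
        using r(1) \<open>0 \<le> c\<close> by (rule mult_left_mono)
      ultimately show ?thesis
        by (simp add: algebra_simps power2_eq_square)
    qed
    also have "\<dots> = (\<zeta> * ?r s + ?c) * ?r s"
      by (simp add: algebra_simps power2_eq_square)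
    finally have "(v s \<bullet> v' s) / ?r s \<le> \<zeta> * ?r s + ?c"
      using r(3) by (subst pos_divide_le_eq)
    then have "exp (- \<zeta> * s) * ((v s \<bullet> v' s) / ?r s - \<zeta> * ?r s - ?c) \<le> 0"
      by (simp add: mult_le_0_iff)
    with dw show "\<exists>y. DERIV ?w s :> y \<and> y \<le> 0"
      by blast
  qed
  then have "exp (\<zeta> * t) * ?w t \<le> exp (\<zeta> * t) * ?w 0"
    by simp
  then have "?r t + ?c / \<zeta> \<le> exp (\<zeta> * t) * (?r 0 + ?c / \<zeta>)"
    by (simp add: mult.assoc[symmetric] exp_add[symmetric])
  moreover have "norm (v t) \<le> ?r t"
    by (auto intro!: real_le_rsqrt simp: power2_norm_eq_inner)
  ultimately show ?thesis
    by (simp add: power2_norm_eq_inner algebra_simps diff_divide_distrib add_divide_distrib)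
qed

text \<open>The regularised bound holds for every \<open>\<delta> > 0\<close> and its right side is
  continuous in \<open>\<delta>\<close>, so \<open>\<delta>\<close> can tend to 0.\<close>

lemma norm_gronwall:
  fixes v :: "real \<Rightarrow> 'a::real_inner"
  assumes "\<And>s. s \<in> {0..t} \<Longrightarrow> (v has_vector_derivative v' s) (at s within {0..t})"
    and "\<And>s. s \<in> {0..t} \<Longrightarrow> v s \<bullet> v' s \<le> \<zeta> * (norm (v s))\<^sup>2 + c * norm (v s)"
    and "\<zeta> \<noteq> 0" "0 \<le> t" "0 \<le> c"
  shows "norm (v t) \<le> norm (v 0) * exp (\<zeta> * t) + (exp (\<zeta> * t) - 1) / \<zeta> * c"
proof (rule tendsto_lowerbound)
  let ?b = "\<lambda>\<delta>. sqrt ((norm (v 0))\<^sup>2 + \<delta>\<^sup>2) * exp (\<zeta> * t)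
    + (exp (\<zeta> * t) - 1) / \<zeta> * (c + \<bar>\<zeta>\<bar> * \<delta>)"
  have "(?b \<longlongrightarrow> ?b 0) (at_right 0)"
    using \<open>\<zeta> \<noteq> 0\<close> by (intro tendsto_intros)
  then show "(?b \<longlongrightarrow> norm (v 0) * exp (\<zeta> * t) + (exp (\<zeta> * t) - 1) / \<zeta> * c) (at_right 0)"
    by simp
  show "\<forall>\<^sub>F \<delta> in at_right 0. norm (v t) \<le> ?b \<delta>"
    using eventually_at_right_less[of 0]
    by eventually_elim (rule norm_gronwall_regularized[OF assms])
qed simp

section \<open>The evolution equation of the true moments and its defect\<close>

text \<open>The gradients are derivatives within \<open>K\<close> only, so the chain rule relies on
  the trajectories staying in \<open>K\<close> throughout \<open>I\<close>.\<close>

lemma moments_has_vector_derivative: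
  fixes x :: "'n::finite \<Rightarrow> real \<Rightarrow> real ^ 'd" and \<phi> :: "'m::finite \<Rightarrow> real ^ 'd \<Rightarrow> real"
  assumes \<phi>: "\<And>k. has_C1_gradient_on (\<phi> k) (grad\<phi> k) K"
    and x: "\<And>i. (x i has_vector_derivative x' i) (at s within I)" "\<And>i. x i ` I \<subseteq> K" "s \<in> I"
  shows "(moments \<phi> x has_vector_derivative
    (\<chi> k. 1 / real CARD('n) * (\<Sum>i\<in>UNIV. grad\<phi> k (x i s) \<bullet> x' i))) (at s within I)"
proof -
  have "((\<lambda>s. \<phi> k (x i s)) has_derivative (\<lambda>h. grad\<phi> k (x i s) \<bullet> (h *\<^sub>R x' i))) (at s within I)"
    for i k
    using has_derivative_in_compose2[of K "\<phi> k" "\<lambda>w v. grad\<phi> k w \<bullet> v" "x i" I s "\<lambda>h. h *\<^sub>R x' i"]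
      \<phi>[of k] x
    by (simp add: has_C1_gradient_on_def has_vector_derivative_def)
  then have "((\<lambda>s. 1 / real CARD('n) * (\<Sum>i\<in>UNIV. \<phi> k (x i s))) has_derivative
      (\<lambda>h. 1 / real CARD('n) * (\<Sum>i\<in>UNIV. grad\<phi> k (x i s) \<bullet> (h *\<^sub>R x' i)))) (at s within I)"
    for k
    by (intro has_derivative_mult_right has_derivative_sum)
  then show ?thesis
    unfolding has_vector_derivative_def
    by (subst has_derivative_componentwise_within)
      (auto simp: Basis_vec_def inner_axis moments_def inner_scaleR_right sum_distrib_left mult_ac)
qed

lemma sum_matrix_vector_mult:
  fixes M :: "'i \<Rightarrow> real ^ 'n ^ 'm"
  shows "(\<Sum>i\<in>S. M i) *v v = (\<Sum>i\<in>S. M i *v v)"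
  by (induction S rule: infinite_finite_induct) (auto simp: matrix_vector_mult_add_rdistrib)

lemma leader_matrix_mult_vec:
  "leader_matrix \<psi> \<Gamma> Y *v m = (\<Sum>j\<in>UNIV. \<Sum>r\<in>UNIV. \<psi> r (Y j) *\<^sub>R (\<Gamma> r *v m))"
  by (simp add: leader_matrix_def sum_matrix_vector_mult scaleR_matrix_vector_assoc)

text \<open>Averaging over agents turns \<open>\<phi> l (x i s)\<close> into \<open>m $ l\<close>,
  and averaging over pairs turns \<open>\<phi> l (x i s) * \<phi> p (x j s)\<close> into
  \<open>m $ l * m $ p\<close>. The kernel expansions thus average exactly to the right side of the
  moment equation, and what remains is the average of \<open>eps\<close> over all pairs of
  agents.\<close>

lemma moment_velocity_eq:
  fixes x :: "'n::finite \<Rightarrow> real \<Rightarrow> real ^ 'd" and \<phi> :: "'m::finite \<Rightarrow> real ^ 'd \<Rightarrow> real"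
    and Y :: "'l::finite \<Rightarrow> real ^ 'd" and \<psi> :: "'r::finite \<Rightarrow> real ^ 'd \<Rightarrow> real"
    and s :: real
  defines "m \<equiv> moments \<phi> x s"
  shows "(\<chi> k. 1 / real CARD('n) * (\<Sum>i\<in>UNIV. grad\<phi> k (x i s) \<bullet>
        (f (x i s) + (1 / real CARD('n)) *\<^sub>R (\<Sum>j\<in>UNIV. g (x i s) (x j s))
          + (\<Sum>j\<in>UNIV. \<eta> (x i s) (Y j)))))
    = A *v m + quad_map B m + leader_matrix \<psi> \<Gamma> Y *v m
      + (\<chi> k. (1 / real CARD('n))\<^sup>2 *
          (\<Sum>i\<in>UNIV. \<Sum>j\<in>UNIV. eps \<phi> grad\<phi> \<psi> f g \<eta> A B \<Gamma> k (x i s) (x j s) Y))"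
proof -
  let ?c = "1 / real CARD('n)"
  have m: "m $ l = ?c * (\<Sum>i\<in>UNIV. \<phi> l (x i s))" for l
    by (simp add: m_def moments_def)
  have lin: "(M *v m) $ k = ?c * (\<Sum>i\<in>UNIV. \<Sum>l\<in>UNIV. M $ k $ l * \<phi> l (x i s))"
    for M :: "real ^ 'm ^ 'm" and k
    unfolding matrix_vector_mult_def m
    by (subst sum.swap) (simp add: sum_distrib_left mult_ac)
  have quad: "quad_map B m $ k = ?c\<^sup>2 * (\<Sum>i\<in>UNIV. \<Sum>j\<in>UNIV. \<Sum>l\<in>UNIV. \<Sum>p\<in>UNIV.
      B k $ l $ p * \<phi> l (x i s) * \<phi> p (x j s))" for k
  proof -
    \<comment> \<open>The kernel sums are moved inside the agent sums in two rounds, first over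
      \<open>p\<close>, then over \<open>l\<close>.\<close>
    have "quad_map B m $ k = (\<Sum>l\<in>UNIV. \<Sum>p\<in>UNIV. \<Sum>i\<in>UNIV. \<Sum>j\<in>UNIV.
        ?c\<^sup>2 * (B k $ l $ p * \<phi> l (x i s) * \<phi> p (x j s)))"
      unfolding quad_map_nth m
      by (simp add: sum_distrib_left sum_distrib_right sum_divide_distrib power2_eq_square mult_ac)
    also have "\<dots> = (\<Sum>l\<in>UNIV. \<Sum>i\<in>UNIV. \<Sum>j\<in>UNIV. \<Sum>p\<in>UNIV.
        ?c\<^sup>2 * (B k $ l $ p * \<phi> l (x i s) * \<phi> p (x j s)))"
      by (subst sum.swap, subst (2) sum.swap) (rule refl)
    also have "\<dots> = (\<Sum>i\<in>UNIV. \<Sum>j\<in>UNIV. \<Sum>l\<in>UNIV. \<Sum>p\<in>UNIV.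
        ?c\<^sup>2 * (B k $ l $ p * \<phi> l (x i s) * \<phi> p (x j s)))"
      by (subst sum.swap, subst (2) sum.swap) (rule refl)
    finally show ?thesis
      by (simp only: sum_distrib_left)
  qed
  have leader: "leader_matrix \<psi> \<Gamma> Y $ k $ l = (\<Sum>j\<in>UNIV. \<Sum>r\<in>UNIV. \<Gamma> r $ k $ l * \<psi> r (Y j))" for k l
    by (simp add: leader_matrix_def mult.commute)
  have lead: "(leader_matrix \<psi> \<Gamma> Y *v m) $ k = ?c * (\<Sum>i\<in>UNIV. \<Sum>j\<in>UNIV. \<Sum>l\<in>UNIV. \<Sum>r\<in>UNIV.
      \<Gamma> r $ k $ l * \<psi> r (Y j) * \<phi> l (x i s))" for k
    unfolding lin leader
    by (subst (3) sum.swap) (simp only: sum_distrib_right)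
  \<comment> \<open>The defects of \<open>f\<close> and \<open>\<eta>\<close> do not depend on the
    second agent, so summing over it gives a factor \<open>CARD('n)\<close> that cancels one of the
    two averaging weights.\<close>
  have card: "?c\<^sup>2 * (real CARD('n) * a) = ?c * a" for a
    by (simp add: power2_eq_square)
  have defect: "?c\<^sup>2 * (\<Sum>i\<in>UNIV. \<Sum>j\<in>UNIV. eps \<phi> grad\<phi> \<psi> f g \<eta> A B \<Gamma> k (x i s) (x j s) Y)
    = ?c * (\<Sum>i\<in>UNIV. eps_f \<phi> grad\<phi> f A k (x i s))
      + ?c\<^sup>2 * (\<Sum>i\<in>UNIV. \<Sum>j\<in>UNIV. eps_g \<phi> grad\<phi> g B k (x i s) (x j s))
      + ?c * (\<Sum>i\<in>UNIV. \<Sum>j\<in>UNIV. eps_eta \<phi> grad\<phi> \<psi> \<eta> \<Gamma> k (x i s) (Y j))" for k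
    by (simp add: eps_def sum.distrib distrib_left card sum_distrib_left[symmetric] del: power_one_over)
  show ?thesis
    unfolding vec_eq_iff vector_add_component vec_lambda_beta defect lead quad
    unfolding lin eps_f_def eps_g_def eps_eta_def
    by (simp add: sum_subtractf sum.distrib inner_add_right inner_sum_right distrib_left
        right_diff_distrib sum_distrib_left[symmetric] power2_eq_square)
      (simp add: sum_divide_distrib)
qed

section \<open>Finiteness of the suprema, so that they bound each of their members\<close>

text \<open>The three parts of \<open>eps\<close> are continuous on \<open>K\<close> or
  \<open>K \<times> K\<close> and are bounded there separately. The leader sum is then bounded term
  by term, which avoids a topology on the tuples \<open>Y\<close>.\<close>

lemma bdd_above_eps_sq:
  fixes \<phi> :: "'m::finite \<Rightarrow> real ^ 'd \<Rightarrow> real" and \<psi> :: "'r::finite \<Rightarrow> real ^ 'd \<Rightarrow> real"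
  assumes K: "compact K"
    and f: "continuous_on K f"
    and g: "continuous_on (K \<times> K) (\<lambda>(w, z). g w z)"
    and \<eta>: "continuous_on (K \<times> K) (\<lambda>(w, z). \<eta> w z)"
    and \<phi>: "\<And>k. has_C1_gradient_on (\<phi> k) (grad\<phi> k) K"
    and \<psi>: "\<And>r. continuous_on K (\<psi> r)"
  shows "bdd_above ((\<lambda>(w, z, Y). (eps \<phi> grad\<phi> \<psi> f g \<eta> A B \<Gamma> k w z Y)\<^sup>2)
    ` (K \<times> K \<times> {Y :: 'l::finite \<Rightarrow> real ^ 'd. \<forall>j. Y j \<in> K}))"
proof -
  have grad: "continuous_on K (grad\<phi> k)" and cont\<phi>: "continuous_on K (\<phi> l)" for k l
    using \<phi> has_derivative_continuous_on[of K "\<phi> l" "\<lambda>w v. grad\<phi> l w \<bullet> v"]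
    by (auto simp: has_C1_gradient_on_def)
  have fst: "continuous_on (K \<times> K) (\<lambda>p. h (fst p))" and snd: "continuous_on (K \<times> K) (\<lambda>p. h (snd p))"
    if "continuous_on K h" for h :: "real ^ 'd \<Rightarrow> 'b::topological_space"
    by (rule continuous_on_compose2[OF that]; auto intro!: continuous_intros)+
  have bound: "\<exists>C. \<forall>p\<in>S. \<bar>h p\<bar> \<le> C" if "continuous_on S h" "compact S"
    for h :: "'b::metric_space \<Rightarrow> real" and S
    using compact_imp_bounded[OF compact_continuous_image[OF that]] by (auto simp: bounded_iff)
  have "continuous_on K (eps_f \<phi> grad\<phi> f A k)"
    unfolding eps_f_def by (intro continuous_intros grad cont\<phi> f)
  from bound[OF this K] obtain Cf where Cf: "\<And>w. w \<in> K \<Longrightarrow> \<bar>eps_f \<phi> grad\<phi> f A k w\<bar> \<le> Cf"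
    by blast
  have "continuous_on (K \<times> K) (\<lambda>p. eps_g \<phi> grad\<phi> g B k (fst p) (snd p))"
    unfolding eps_g_def
    by (intro continuous_intros fst snd grad cont\<phi> g[unfolded case_prod_unfold])
  from bound[OF this compact_Times[OF K K]] obtain Cg
    where Cg: "\<And>w z. w \<in> K \<Longrightarrow> z \<in> K \<Longrightarrow> \<bar>eps_g \<phi> grad\<phi> g B k w z\<bar> \<le> Cg"
    by fastforce
  have "continuous_on (K \<times> K) (\<lambda>p. eps_eta \<phi> grad\<phi> \<psi> \<eta> \<Gamma> k (fst p) (snd p))"
    unfolding eps_eta_def
    by (intro continuous_intros fst snd grad cont\<phi> \<psi> \<eta>[unfolded case_prod_unfold])
  from bound[OF this compact_Times[OF K K]] obtain Ch
    where Ch: "\<And>w z. w \<in> K \<Longrightarrow> z \<in> K \<Longrightarrow> \<bar>eps_eta \<phi> grad\<phi> \<psi> \<eta> \<Gamma> k w z\<bar> \<le> Ch"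
    by fastforce
  have "(eps \<phi> grad\<phi> \<psi> f g \<eta> A B \<Gamma> k w z Y)\<^sup>2 \<le> (Cf + Cg + (\<Sum>j\<in>(UNIV :: 'l set). Ch))\<^sup>2"
    if "w \<in> K" "z \<in> K" "\<forall>j. Y j \<in> K" for w z and Y :: "'l \<Rightarrow> real ^ 'd"
  proof -
    have "\<bar>\<Sum>j\<in>UNIV. eps_eta \<phi> grad\<phi> \<psi> \<eta> \<Gamma> k w (Y j)\<bar> \<le> (\<Sum>j\<in>(UNIV :: 'l set). Ch)"
      using that by (intro order_trans[OF sum_abs] sum_mono Ch) auto
    then have "\<bar>eps \<phi> grad\<phi> \<psi> f g \<eta> A B \<Gamma> k w z Y\<bar> \<le> Cf + Cg + (\<Sum>j\<in>(UNIV :: 'l set). Ch)"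
      unfolding eps_def using Cf[OF that(1)] Cg[OF that(1,2)] by linarith
    then show ?thesis
      by (rule abs_le_square_iff[THEN iffD1, OF order_trans]) simp
  qed
  then show ?thesis
    by (intro bdd_aboveI2[where M = "(Cf + Cg + (\<Sum>j\<in>(UNIV :: 'l set). Ch))\<^sup>2"]) auto
qed

lemma lipschitz_in_each_imp_continuous_on:
  fixes g :: "'a::metric_space \<Rightarrow> 'b::metric_space \<Rightarrow> 'c::metric_space"
  assumes "\<forall>z\<in>T. L-lipschitz_on S (\<lambda>w. g w z)" "\<forall>w\<in>S. M-lipschitz_on T (g w)"
  shows "continuous_on (S \<times> T) (\<lambda>(w, z). g w z)"
\<comment> \<open>With an empty factor an assumption can be vacuous, and nonnegativity of its
  constant could not be inferred.\<close>
proof (cases "S = {} \<or> T = {}")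
  case False
  then have "0 \<le> L" "0 \<le> M"
    using assms lipschitz_on_nonneg by blast+
  have "(L + M)-lipschitz_on (S \<times> T) (\<lambda>(w, z). g w z)"
  proof (rule lipschitz_onI, clarify)
    fix w z w' z' assume in_ST: "w \<in> S" "z \<in> T" "w' \<in> S" "z' \<in> T"
    have "dist (g w z) (g w' z') \<le> dist (g w z) (g w' z) + dist (g w' z) (g w' z')"
      by (rule dist_triangle)
    also have "\<dots> \<le> L * dist w w' + M * dist z z'"
      using in_ST lipschitz_onD[OF assms(1)[rule_format], of z w w'] lipschitz_onD[OF assms(2)[rule_format], of w' z z']
      by (intro add_mono) auto
    also have "\<dots> \<le> L * dist (w, z) (w', z') + M * dist (w, z) (w', z')"
      using \<open>0 \<le> L\<close> \<open>0 \<le> M\<close> dist_fst_le[of "(w, z)" "(w', z')"] dist_snd_le[of "(w, z)" "(w', z')"]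
      by (intro add_mono mult_left_mono) auto
    finally show "dist (g w z) (g w' z') \<le> (L + M) * dist (w, z) (w', z')"
      by (simp add: distrib_right)
  qed (use \<open>0 \<le> L\<close> \<open>0 \<le> M\<close> in simp)
  then show ?thesis
    by (rule lipschitz_on_continuous_on)
qed auto

text \<open>Boundedness above comes from the operator norm: it scales with
  \<open>\<bar>m $ l\<bar>\<close>, and components are bounded on the compact set
  \<open>D\<close>.\<close>

lemma sum_log_norm_le_beta:
  fixes B :: "'m::finite \<Rightarrow> real ^ 'm ^ 'm"
  assumes "compact D" "p \<in> D"
  shows "(\<Sum>l\<in>UNIV. log_norm (p $ l *\<^sub>R B_tilde B l)) \<le> beta D B"
  unfolding beta_def
proof (rule cSUP_upper[OF \<open>p \<in> D\<close>])
  obtain C where C: "\<And>m. m \<in> D \<Longrightarrow> norm m \<le> C"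
    using compact_imp_bounded[OF \<open>compact D\<close>] by (auto simp: bounded_iff)
  have "log_norm (m $ l *\<^sub>R B_tilde B l) \<le> C * onorm ((*v) (B_tilde B l))" if "m \<in> D" for m l
  proof -
    have "log_norm (m $ l *\<^sub>R B_tilde B l) \<le> \<bar>m $ l\<bar> * onorm ((*v) (B_tilde B l))"
      using log_norm_le_onorm[of "m $ l *\<^sub>R B_tilde B l"]
      by (simp add: onorm_scaleR_matrix)
    also have "\<dots> \<le> C * onorm ((*v) (B_tilde B l))"
      using C[OF that] component_le_norm_cart[of m l]
      by (intro mult_right_mono onorm_pos_le) auto
    finally show ?thesis .
  qed
  then show "bdd_above ((\<lambda>m. \<Sum>l\<in>UNIV. log_norm (m $ l *\<^sub>R B_tilde B l)) ` D)"
    by (intro bdd_aboveI2[where M = "\<Sum>l\<in>UNIV. C * onorm ((*v) (B_tilde B l))"] sum_mono)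
qed

text \<open>The operator norm of the leader matrix is bounded summand by summand, using a bound for
  each \<open>\<psi> r\<close> on \<open>K\<close>.\<close>

lemma log_norm_leader_matrix_le_tau:
  fixes Y :: "'l::finite \<Rightarrow> real ^ 'd" and \<psi> :: "'r::finite \<Rightarrow> real ^ 'd \<Rightarrow> real"
    and \<Gamma> :: "'r \<Rightarrow> real ^ 'm ^ 'm"
  assumes K: "compact K" and \<psi>: "\<And>r. continuous_on K (\<psi> r)" and Y: "\<And>j. Y j \<in> K"
  shows "log_norm (leader_matrix \<psi> \<Gamma> Y) \<le> tau TYPE('l) K \<psi> \<Gamma>"
  unfolding tau_def
proof (rule cSUP_upper)
  have "\<exists>C. \<forall>z\<in>K. \<bar>\<psi> r z\<bar> \<le> C" for r
    using compact_imp_bounded[OF compact_continuous_image[OF \<psi> K], of r] by (auto simp: bounded_iff)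
  then obtain C where C: "\<And>r z. z \<in> K \<Longrightarrow> \<bar>\<psi> r z\<bar> \<le> C r"
    by metis
  have "log_norm (leader_matrix \<psi> \<Gamma> Z) \<le> (\<Sum>j\<in>(UNIV :: 'l set). \<Sum>r\<in>UNIV. C r * onorm ((*v) (\<Gamma> r)))"
    if "\<And>j. Z j \<in> K" for Z :: "'l \<Rightarrow> real ^ 'd"
  proof -
    have bl: "bounded_linear (\<lambda>v. \<psi> r (Z j) *\<^sub>R (\<Gamma> r *v v))" for r j
      by (intro bounded_linear_const_scaleR) auto
    have "log_norm (leader_matrix \<psi> \<Gamma> Z) \<le> onorm ((*v) (leader_matrix \<psi> \<Gamma> Z))"
      by (rule log_norm_le_onorm)
    also have "(*v) (leader_matrix \<psi> \<Gamma> Z) = (\<lambda>v. \<Sum>j\<in>UNIV. \<Sum>r\<in>UNIV. \<psi> r (Z j) *\<^sub>R (\<Gamma> r *v v))"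
      by (simp add: fun_eq_iff leader_matrix_mult_vec)
    also have "onorm \<dots> \<le> (\<Sum>j\<in>UNIV. \<Sum>r\<in>UNIV. onorm (\<lambda>v. \<psi> r (Z j) *\<^sub>R (\<Gamma> r *v v)))"
      by (intro order_trans[OF onorm_sum] sum_mono onorm_sum bounded_linear_sum bl) auto
    also have "\<dots> \<le> (\<Sum>j\<in>(UNIV :: 'l set). \<Sum>r\<in>UNIV. C r * onorm ((*v) (\<Gamma> r)))"
      using C that by (intro sum_mono) (auto simp: onorm_scaleR intro!: mult_right_mono onorm_pos_le)
    finally show ?thesis .
  qed
  then show "bdd_above ((\<lambda>Y. log_norm (leader_matrix \<psi> \<Gamma> Y)) ` {Y :: 'l \<Rightarrow> real ^ 'd. \<forall>j. Y j \<in> K})"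
    by (intro bdd_aboveI2[where M = "\<Sum>j\<in>(UNIV :: 'l set). \<Sum>r\<in>UNIV. C r * onorm ((*v) (\<Gamma> r))"]) auto
qed (use Y in simp)

lemma abs_average_le:
  fixes e :: "'n::finite \<Rightarrow> 'n \<Rightarrow> real"
  assumes "\<And>i j. \<bar>e i j\<bar> \<le> C"
  shows "\<bar>(1 / real CARD('n))\<^sup>2 * (\<Sum>i\<in>UNIV. \<Sum>j\<in>UNIV. e i j)\<bar> \<le> C"
proof -
  have "\<bar>\<Sum>i\<in>UNIV. \<Sum>j\<in>UNIV. e i j\<bar> \<le> (\<Sum>i\<in>(UNIV :: 'n set). \<Sum>j\<in>(UNIV :: 'n set). C)"
    using assms by (intro order_trans[OF sum_abs] sum_mono)
  then have "(1 / real CARD('n))\<^sup>2 * \<bar>\<Sum>i\<in>UNIV. \<Sum>j\<in>UNIV. e i j\<bar>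
      \<le> (1 / real CARD('n))\<^sup>2 * (\<Sum>i\<in>(UNIV :: 'n set). \<Sum>j\<in>(UNIV :: 'n set). C)"
    by (intro mult_left_mono) auto
  also have "\<dots> = C"
    by (simp add: power2_eq_square)
  finally show ?thesis
    by (simp add: abs_mult)
qed

section \<open>The differential inequality for the error trajectory\<close>

theorem corollary6:
  fixes K :: "(real ^ 'd) set"
    and f :: "real ^ 'd \<Rightarrow> real ^ 'd"
    and g \<eta> :: "real ^ 'd \<Rightarrow> real ^ 'd \<Rightarrow> real ^ 'd"
    and \<phi> :: "'m::finite \<Rightarrow> real ^ 'd \<Rightarrow> real"
    and grad\<phi> :: "'m \<Rightarrow> real ^ 'd \<Rightarrow> real ^ 'd"
    and \<psi> :: "'r::finite \<Rightarrow> real ^ 'd \<Rightarrow> real"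
    and x :: "'n::finite \<Rightarrow> real \<Rightarrow> real ^ 'd"
    and y :: "'l::finite \<Rightarrow> real \<Rightarrow> real ^ 'd"
    and A :: "real ^ 'm ^ 'm"
    and B :: "'m \<Rightarrow> real ^ 'm ^ 'm"
    and \<Gamma> :: "'r \<Rightarrow> real ^ 'm ^ 'm"
    and mbar :: "real \<Rightarrow> real ^ 'm"
    and D :: "(real ^ 'm) set"
    and T Tbar \<zeta> t :: real
  defines "\<zeta> \<equiv> log_norm A + beta D B + tau TYPE('l) K \<psi> \<Gamma>"
  assumes K: "compact K" "convex K"
    and f: "\<exists>L. L-lipschitz_on K f"
    and g: "\<exists>L. \<forall>z\<in>K. L-lipschitz_on K (\<lambda>w. g w z)" "\<exists>L. \<forall>w\<in>K. L-lipschitz_on K (g w)"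
    and \<eta>: "C1_on (K \<times> K) (\<lambda>(w, z). \<eta> w z)"
    and \<phi>: "\<And>k. has_C1_gradient_on (\<phi> k) (grad\<phi> k) K"
    and \<psi>: "\<And>r. continuous_on K (\<psi> r)"
    and y_in: "\<And>j s. s \<in> {0..T} \<Longrightarrow> y j s \<in> K"
    and x_ode: "\<And>i s. s \<in> {0..T} \<Longrightarrow>
      (x i has_vector_derivative
        (f (x i s) + (1 / real CARD('n)) *\<^sub>R (\<Sum>j\<in>UNIV. g (x i s) (x j s))
          + (\<Sum>j\<in>UNIV. \<eta> (x i s) (y j s)))) (at s within {0..T})"
    and x_in: "\<And>i s. s \<in> {0..T} \<Longrightarrow> x i s \<in> K"
    and mbar_ode: "\<And>s. s \<in> {0..Tbar} \<Longrightarrow>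
      (mbar has_vector_derivative
        (A *v mbar s + quad_map B (mbar s)
          + (\<Sum>j\<in>UNIV. \<Sum>r\<in>UNIV. \<psi> r (y j s) *\<^sub>R (\<Gamma> r *v mbar s)))) (at s within {0..Tbar})"
    and D: "compact D" "convex D"
    and mbar_in: "\<And>s. s \<in> {0..Tbar} \<Longrightarrow> mbar s \<in> D"
    and m_in: "\<And>s. s \<in> {0..min T Tbar} \<Longrightarrow> moments \<phi> x s \<in> D"
    and \<zeta>: "\<zeta> \<noteq> 0"
    and t: "t \<in> {0..min T Tbar}"
  shows "norm (moments \<phi> x t - mbar t) \<le>
    norm (moments \<phi> x 0 - mbar 0) * exp (\<zeta> * t)
    + (exp (\<zeta> * t) - 1) / \<zeta> *
      sqrt (\<Sum>k\<in>UNIV. SUP (w, z, Y)\<in>K \<times> K \<times> {Y :: 'l \<Rightarrow> real ^ 'd. \<forall>j. Y j \<in> K}.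
        (eps \<phi> grad\<phi> \<psi> f g \<eta> A B \<Gamma> k w z Y)\<^sup>2)"
proof -
  let ?E = "\<lambda>s. \<chi> k. (1 / real CARD('n))\<^sup>2 * (\<Sum>i\<in>UNIV. \<Sum>j\<in>UNIV.
    eps \<phi> grad\<phi> \<psi> f g \<eta> A B \<Gamma> k (x i s) (x j s) (\<lambda>j. y j s))"
  let ?sup = "\<lambda>k. SUP (w, z, Y)\<in>K \<times> K \<times> {Y :: 'l \<Rightarrow> real ^ 'd. \<forall>j. Y j \<in> K}.
    (eps \<phi> grad\<phi> \<psi> f g \<eta> A B \<Gamma> k w z Y)\<^sup>2"
  let ?P = "\<lambda>s. \<Sum>l\<in>UNIV. ((1/2) *\<^sub>R (moments \<phi> x s + mbar s)) $ l *\<^sub>R B_tilde B l"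
  let ?L = "\<lambda>s. leader_matrix \<psi> \<Gamma> (\<lambda>j. y j s)"
  let ?\<Delta> = "\<lambda>s. moments \<phi> x s - mbar s"
  have contf: "continuous_on K f"
    using f lipschitz_on_continuous_on by blast
  have contg: "continuous_on (K \<times> K) (\<lambda>(w, z). g w z)"
    using g lipschitz_in_each_imp_continuous_on by blast
  have cont\<eta>: "continuous_on (K \<times> K) (\<lambda>(w, z). \<eta> w z)"
  proof -
    obtain \<eta>' :: "(real ^ 'd) \<times> (real ^ 'd) \<Rightarrow> ((real ^ 'd) \<times> (real ^ 'd)) \<Rightarrow>\<^sub>L (real ^ 'd)"
      where "\<And>p. p \<in> K \<times> K \<Longrightarrow>
        ((\<lambda>(w, z). \<eta> w z) has_derivative blinfun_apply (\<eta>' p)) (at p within K \<times> K)"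
      using \<eta> unfolding C1_on_def by blast
    then show ?thesis
      by (rule has_derivative_continuous_on)
  qed
  have eps_sq_le: "(eps \<phi> grad\<phi> \<psi> f g \<eta> A B \<Gamma> k w z Y)\<^sup>2 \<le> ?sup k"
    if "w \<in> K" "z \<in> K" "\<And>j. Y j \<in> K" for k w z and Y :: "'l \<Rightarrow> real ^ 'd"
    using cSUP_upper[OF _ bdd_above_eps_sq[where A = A and B = B and \<Gamma> = \<Gamma> and k = k,
        OF K(1) contf contg cont\<eta> \<phi> \<psi>], of "(w, z, Y)"] that
    by simp
  have range: "s \<in> {0..T}" "s \<in> {0..Tbar}" "s \<in> {0..min T Tbar}" if "s \<in> {0..t}" for s
    using that t by auto
  \<comment> \<open>Subtracting the two moment equations leaves an equation that is linear in the
    error apart from \<open>?E s\<close>; the matrix \<open>?P s\<close> depends on both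
    trajectories through their midpoint.\<close>
  have \<Delta>_deriv: "(?\<Delta> has_vector_derivative (A *v ?\<Delta> s + ?P s *v ?\<Delta> s + ?L s *v ?\<Delta> s + ?E s))
      (at s within {0..t})" if s: "s \<in> {0..t}" for s
  proof -
    have "(x i has_vector_derivative
        (f (x i s) + (1 / real CARD('n)) *\<^sub>R (\<Sum>j\<in>UNIV. g (x i s) (x j s))
          + (\<Sum>j\<in>UNIV. \<eta> (x i s) (y j s)))) (at s within {0..t})" for i
      by (rule has_vector_derivative_within_subset[OF x_ode[OF range(1)[OF s]]]) (use range(1) in blast)
    from moments_has_vector_derivative[where x = x and \<phi> = \<phi> and I = "{0..t}", OF \<phi> this _ s]
    have m: "(moments \<phi> x has_vector_derivative (A *v moments \<phi> x s + quad_map B (moments \<phi> x s)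
        + ?L s *v moments \<phi> x s + ?E s)) (at s within {0..t})"
      unfolding moment_velocity_eq[where A = A and B = B and \<psi> = \<psi> and \<Gamma> = \<Gamma> and \<phi> = \<phi> and grad\<phi> = grad\<phi>
        and f = f and g = g and \<eta> = \<eta> and x = x and s = s and Y = "\<lambda>j. y j s"]
      using x_in range(1) by blast
    have "(mbar has_vector_derivative (A *v mbar s + quad_map B (mbar s) + ?L s *v mbar s))
        (at s within {0..t})"
      unfolding leader_matrix_mult_vec
      by (rule has_vector_derivative_within_subset[OF mbar_ode[OF range(2)[OF s]]]) (use range(2) in blast)
    from has_vector_derivative_diff[OF m this] show ?thesis
      unfolding quad_map_diff[symmetric] by (simp add: matrix_vector_mult_diff_distrib algebra_simps)
  qed
  \<comment> \<open>Each entry of \<open>?E s\<close> averages values of \<open>eps\<close> at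
    points of \<open>K\<close>, so its square is at most \<open>?sup k\<close>; summing over
    \<open>k\<close> gives the Euclidean norm.\<close>
  have E_le: "norm (?E s) \<le> sqrt (\<Sum>k\<in>UNIV. ?sup k)" if s: "s \<in> {0..t}" for s
  proof -
    have "(?E s $ k)\<^sup>2 \<le> ?sup k" for k
    proof -
      have "\<bar>eps \<phi> grad\<phi> \<psi> f g \<eta> A B \<Gamma> k (x i s) (x j s) (\<lambda>j. y j s)\<bar> \<le> sqrt (?sup k)" for i j
        using x_in y_in range(1)[OF s] by (intro real_le_rsqrt) (auto intro!: eps_sq_le)
      then have "\<bar>?E s $ k\<bar> \<le> sqrt (?sup k)"
        unfolding vec_lambda_beta by (rule abs_average_le)
      then show ?thesis
        using sqrt_ge_absD by blast
    qed
    then show ?thesis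
      unfolding norm_vec_def L2_set_def by (auto intro!: real_sqrt_le_mono sum_mono)
  qed
  show ?thesis
  proof (rule norm_gronwall[OF \<Delta>_deriv _ \<zeta>])
    show "0 \<le> t"
      using t by simp
    \<comment> \<open>Nonnegativity of the constant is read off from the defect bound at time
      0.\<close>
    then show "0 \<le> sqrt (\<Sum>k\<in>UNIV. ?sup k)"
      by (intro order_trans[OF norm_ge_zero E_le[of 0]]) simp
    fix s assume s: "s \<in> {0..t}"
    \<comment> \<open>Both trajectories lie in \<open>D\<close>, so convexity allows
      \<open>beta\<close> to be applied at their midpoint.\<close>
    have mid: "(1/2) *\<^sub>R (moments \<phi> x s + mbar s) \<in> D"
      using convexD[OF D(2) m_in[OF range(3)[OF s]] mbar_in[OF range(2)[OF s]], of "1/2" "1/2"]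
      by (simp add: scaleR_add_right)
    \<comment> \<open>The quadratic form is bounded for each \<open>l\<close> separately, which
      produces the sum of logarithmic norms occurring in \<open>beta\<close>.\<close>
    have "?\<Delta> s \<bullet> (?P s *v ?\<Delta> s)
        \<le> (\<Sum>l\<in>UNIV. log_norm (((1/2) *\<^sub>R (moments \<phi> x s + mbar s)) $ l *\<^sub>R B_tilde B l) * (norm (?\<Delta> s))\<^sup>2)"
      unfolding sum_matrix_vector_mult inner_sum_right
      by (intro sum_mono inner_matrix_vector_le_log_norm)
    also have "\<dots> \<le> beta D B * (norm (?\<Delta> s))\<^sup>2"
      unfolding sum_distrib_right[symmetric]
      by (intro mult_right_mono sum_log_norm_le_beta D mid) auto
    finally have "?\<Delta> s \<bullet> (?P s *v ?\<Delta> s) \<le> beta D B * (norm (?\<Delta> s))\<^sup>2" .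
    moreover have "?\<Delta> s \<bullet> (?L s *v ?\<Delta> s) \<le> tau TYPE('l) K \<psi> \<Gamma> * (norm (?\<Delta> s))\<^sup>2"
      using y_in range(1)[OF s]
      by (intro order_trans[OF inner_matrix_vector_le_log_norm] mult_right_mono
          log_norm_leader_matrix_le_tau K \<psi>) auto
    moreover have "?\<Delta> s \<bullet> (A *v ?\<Delta> s) \<le> log_norm A * (norm (?\<Delta> s))\<^sup>2"
      by (rule inner_matrix_vector_le_log_norm)
    moreover have "?\<Delta> s \<bullet> ?E s \<le> sqrt (\<Sum>k\<in>UNIV. ?sup k) * norm (?\<Delta> s)"
      unfolding mult.commute[of _ "norm (?\<Delta> s)"]
      by (intro order_trans[OF norm_cauchy_schwarz] mult_left_mono E_le s norm_ge_zero)
    ultimately show "?\<Delta> s \<bullet> (A *v ?\<Delta> s + ?P s *v ?\<Delta> s + ?L s *v ?\<Delta> s + ?E s)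
        \<le> \<zeta> * (norm (?\<Delta> s))\<^sup>2 + sqrt (\<Sum>k\<in>UNIV. ?sup k) * norm (?\<Delta> s)"
      unfolding \<zeta>_def inner_add_right distrib_right by linarith
  qed
qed

end
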